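(* Let $\mathbb{F}_q$ be a finite field with $q$ elements, let $a\in\mathbb{F}_q^{\times}$, and write $t:=q^{-s}$. For the Lie algebras over $\mathbb{F}_q$ defined in the context, the subalgebra zeta functions are \begin{align*} \zeta_{L_{1,1}(\mathbb{F}_q)}^{\leq}(s)&=1+t,\\ \zeta_{L_{2,1}(\mathbb{F}_q)}^{\leq}(s)&=1+(1+q)t+t^2,\\ \zeta_{L_{2,2}(\mathbb{F}_q)}^{\leq}(s)&=1+(1+q)t+t^2,\\ \zeta_{L^{1}(\mathbb{F}_q)}^{\leq}(s)&=1+(1+q+q^2)t+(1+q+q^2)t^2+t^3,\\ \zeta_{L^{2}(\mathbb{F}_q)}^{\leq}(s)&=1+(1+q+q^2)t+(1+q+q^2)t^2+t^3,\\ \zeta_{L_a^{3}(\mathbb{F}_q)}^{\leq}(s)&=1+(1+|V_{3,a}(\mathbb{F}_q)|q)t+(1+q+q^2)t^2+t^3,\\ \zeta_{L_0^{3}(\mathbb{F}_q)}^{\leq}(s)&=1+(1+2q)t+(1+q+q^2)t^2+t^3,\\ \zeta_{L_a^{4}(\mathbb{F}_q)}^{\leq}(s)&=1+(1+|V_{4,a}(\mathbb{F}_q)|q)t+(1+q+q^2)t^2+t^3,\\ \zeta_{L_0^{4}(\mathbb{F}_q)}^{\leq}(s)&=1+(1+q)t+(1+q+q^2)t^2+t^3. \end{align*}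
   Context: For a Lie algebra $L$ over $\mathbb{F}_q$ of finite dimension $n$, the subalgebra zeta function is $\zeta_L^{\leq}(s)=\sum_{i=0}^{n}a^{\leq}_{q^i}(L)\,t^{i}$, where $t=q^{-s}$ and $a^{\leq}_{q^i}(L)$ is the number of Lie subalgebras of $L$ (over $\mathbb{F}_q$) of codimension $i$ (index $q^i$). The Lie algebras below are given by an $\mathbb{F}_q$-basis $e_1,e_2,\dots$ and brackets; up to antisymmetry all brackets of basis elements that are not listed are zero. - $L_{1,1}(\mathbb{F}_q)$: basis $e_1$, abelian. - $L_{2,1}(\mathbb{F}_q)$: basis $e_1,e_2$, abelian. - $L_{2,2}(\mathbb{F}_q)$: basis $e_1,e_2$, $[e_1,e_2]=e_2$. - $L^1(\mathbb{F}_q)$: basis $e_1,e_2,e_3$, abelian. - $L^2(\mathbb{F}_q)$: basis $e_1,e_2,e_3$, $[e_3,e_1]=e_1$, $[e_3,e_2]=e_2$. - $L_a^3(\mathbb{F}_q)$ (for $a\in\mathbb{F}_q$): basis $e_1,e_2,e_3$, $[e_3,e_1]=e_2$, $[e_3,e_2]=ae_1+e_2$. - $L_a^4(\mathbb{F}_q)$ (for $a\in\mathbb{F}_q$): basis $e_1,e_2,e_3$, $[e_3,e_1]=e_2$, $[e_3,e_2]=ae_1$. Moreover $|V_{3,a}(\mathbb{F}_q)|=|\{x\in\mathbb{F}_q: ax^2-x-1=0\}|$ and $|V_{4,a}(\mathbb{F}_q)|=|\{x\in\mathbb{F}_q: ax^2-1=0\}|$. *)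

theory Defs
  imports "HOL-Analysis.Analysis"
begin

locale lie_algebra = finite_dimensional_vector_space scale Basis
  for scale :: "'k::{field,finite} \<Rightarrow> 'v::ab_group_add \<Rightarrow> 'v"
    and Basis :: "'v set" +
  fixes bracket :: "'v \<Rightarrow> 'v \<Rightarrow> 'v"
  assumes bracket_add_left: "bracket (x + y) z = bracket x z + bracket y z"
    and bracket_add_right: "bracket x (y + z) = bracket x y + bracket x z"
    and bracket_scale_left: "bracket (scale c x) y = scale c (bracket x y)"
    and bracket_scale_right: "bracket x (scale c y) = scale c (bracket x y)"
    and bracket_self: "bracket x x = 0"
    and jacobi: "bracket x (bracket y z) + bracket y (bracket z x) + bracket z (bracket x y) = 0"
begin

definition subalgebra :: "'v set \<Rightarrow> bool" where
  "subalgebra S \<longleftrightarrow> subspace S \<and> (\<forall>x\<in>S. \<forall>y\<in>S. bracket x y \<in> S)"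

definition subalgebra_count :: "nat \<Rightarrow> nat" where
  "subalgebra_count i = card {S. subalgebra S \<and> dim S + i = dim UNIV}"

definition subalgebra_zeta :: "complex \<Rightarrow> complex" where
  "subalgebra_zeta s =
    (\<Sum>i\<le>dim UNIV. of_nat (subalgebra_count i) * (of_nat CARD('k) powr (- s)) ^ i)"

end

text \<open>
  A Lie algebra with basis \<open>e\<^sub>1, \<dots>, e\<^sub>n\<close> is realised on the coordinate space \<open>'k ^ 'n\<close>, with
  \<open>e\<^sub>i = axis i 1\<close>, and is represented by its bracket. Note that \<open>3 = 0\<close> in the index type \<open>3\<close>
  (and \<open>2 = 0\<close> in \<open>2\<close>), so that \<open>1, 2, 3\<close> are exactly its elements.
\<close>

type_synonym ('k, 'n) bracket = "'k ^ 'n \<Rightarrow> 'k ^ 'n \<Rightarrow> 'k ^ 'n"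

abbreviation zeta :: "('k::{field,finite}, 'n::finite) bracket \<Rightarrow> complex \<Rightarrow> complex" where
  "zeta \<equiv> lie_algebra.subalgebra_zeta (*s)"

abbreviation basis_vec :: "'n::finite \<Rightarrow> 'k::field ^ 'n" where
  "basis_vec i \<equiv> axis i 1"

text \<open>
  The bilinear alternating extension of a table \<open>c\<close> of brackets of basis elements, in which each
  unordered pair \<open>i \<noteq> j\<close> is listed in at most one order and all other entries are zero.
\<close>

definition bracket_of :: "('n \<Rightarrow> 'n \<Rightarrow> 'k ^ 'n) \<Rightarrow> ('k::field, 'n::finite) bracket" where
  "bracket_of c x y = (\<Sum>i\<in>UNIV. \<Sum>j\<in>UNIV. (x $ i * y $ j) *s (c i j - c j i))"

definition L_1_1 :: "('k::field, 1) bracket" where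
  "L_1_1 = bracket_of (\<lambda>i j. 0)"

definition L_2_1 :: "('k::field, 2) bracket" where
  "L_2_1 = bracket_of (\<lambda>i j. 0)"

definition L_2_2 :: "('k::field, 2) bracket" where
  "L_2_2 = bracket_of (\<lambda>i j. if (i, j) = (1, 2) then basis_vec 2 else 0)"

definition L1 :: "('k::field, 3) bracket" where
  "L1 = bracket_of (\<lambda>i j. 0)"

definition L2 :: "('k::field, 3) bracket" where
  "L2 = bracket_of (\<lambda>i j. if (i, j) = (3, 1) then basis_vec 1
                          else if (i, j) = (3, 2) then basis_vec 2 else 0)"

definition L3 :: "'k::field \<Rightarrow> ('k, 3) bracket" where
  "L3 a = bracket_of (\<lambda>i j. if (i, j) = (3, 1) then basis_vec 2
                            else if (i, j) = (3, 2) then a *s basis_vec 1 + basis_vec 2 else 0)"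

definition L4 :: "'k::field \<Rightarrow> ('k, 3) bracket" where
  "L4 a = bracket_of (\<lambda>i j. if (i, j) = (3, 1) then basis_vec 2
                            else if (i, j) = (3, 2) then a *s basis_vec 1 else 0)"

definition V3 :: "'k::field \<Rightarrow> 'k set" where
  "V3 a = {x. a * x ^ 2 - x - 1 = 0}"

definition V4 :: "'k::field \<Rightarrow> 'k set" where
  "V4 a = {x. a * x ^ 2 - 1 = 0}"

lemma bracket_of_basis_vec: "bracket_of c (basis_vec i) (basis_vec j) = c i j - c j i"
proof -
  have "bracket_of c (basis_vec i) (basis_vec j) =
      (\<Sum>k\<in>UNIV. \<Sum>l\<in>UNIV. if k = i then (if l = j then c k l - c l k else 0) else 0)"
    unfolding bracket_of_def by (intro sum.cong refl) (auto simp: axis_def)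
  also have "\<dots> = (\<Sum>k\<in>UNIV. if k = i then c k j - c j k else 0)"
    by (intro sum.cong refl) simp
  finally show ?thesis by simp
qed

lemma brackets_L_2_2: "L_2_2 (basis_vec 1) (basis_vec 2) = basis_vec 2"
  by (simp add: L_2_2_def bracket_of_basis_vec)

lemma brackets_L2:
  "L2 (basis_vec 3) (basis_vec 1) = basis_vec 1" "L2 (basis_vec 3) (basis_vec 2) = basis_vec 2" "L2 (basis_vec 1) (basis_vec 2) = 0"
  by (simp_all add: L2_def bracket_of_basis_vec)

lemma brackets_L3:
  "L3 a (basis_vec 3) (basis_vec 1) = basis_vec 2" "L3 a (basis_vec 3) (basis_vec 2) = a *s basis_vec 1 + basis_vec 2" "L3 a (basis_vec 1) (basis_vec 2) = 0"
  by (simp_all add: L3_def bracket_of_basis_vec)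

lemma brackets_L4:
  "L4 a (basis_vec 3) (basis_vec 1) = basis_vec 2" "L4 a (basis_vec 3) (basis_vec 2) = a *s basis_vec 1" "L4 a (basis_vec 1) (basis_vec 2) = 0"
  by (simp_all add: L4_def bracket_of_basis_vec)

lemma lie_algebra_bracket_ofI:
  assumes "\<And>x y z. bracket_of c x (bracket_of c y z) + bracket_of c y (bracket_of c z x)
                    + bracket_of c z (bracket_of c x y) = 0"
  shows "lie_algebra (*s) cart_basis (bracket_of c :: ('k::{field,finite}, 'n::finite) bracket)"
proof (unfold_locales, goal_cases)
  case (5 x)
  let ?f = "\<lambda>i j. (x $ i * x $ j) *s c i j"
  have "bracket_of c x x = (\<Sum>i\<in>UNIV. \<Sum>j\<in>UNIV. ?f i j) - (\<Sum>i\<in>UNIV. \<Sum>j\<in>UNIV. ?f j i)"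
    by (simp add: bracket_of_def vec.scale_right_diff_distrib sum_subtractf mult.commute)
  also have "(\<Sum>i\<in>UNIV. \<Sum>j\<in>UNIV. ?f j i) = (\<Sum>i\<in>UNIV. \<Sum>j\<in>UNIV. ?f i j)"
    by (rule sum.swap)
  finally show ?case by simp
next
  case (6 x y z)
  show ?case by (rule assms)
qed (simp_all only: bracket_of_def vector_add_component vector_smult_component distrib_left
       distrib_right vec.scale_left_distrib sum.distrib vec.scale_sum_right vec.scale_scale ac_simps)

lemma lie_algebras:
  "lie_algebra (*s) cart_basis (L_1_1 :: ('k::{field,finite}, 1) bracket)"
  "lie_algebra (*s) cart_basis (L_2_1 :: ('k, 2) bracket)"
  "lie_algebra (*s) cart_basis (L_2_2 :: ('k, 2) bracket)"
  "lie_algebra (*s) cart_basis (L1 :: ('k, 3) bracket)"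
  "lie_algebra (*s) cart_basis (L2 :: ('k, 3) bracket)"
  "lie_algebra (*s) cart_basis (L3 (a :: 'k))"
  "lie_algebra (*s) cart_basis (L4 (a :: 'k))"
  unfolding L_1_1_def L_2_1_def L_2_2_def L1_def L2_def L3_def L4_def
  by (rule lie_algebra_bracket_ofI,
      simp add: bracket_of_def vec_eq_iff sum_1 sum_2 sum_3 forall_1 forall_2 forall_3 axis_def
        algebra_simps)+

end

theory Submission
  imports Defs
begin

text \<open>
  Every line is a subalgebra because the bracket is alternating, so only the subalgebras of
  codimension 1 of the three-dimensional algebras need work. All of these algebras have the form
  \<open>V \<rtimes> k e\<^sub>3\<close> with \<open>V = \<langle>e\<^sub>1, e\<^sub>2\<rangle>\<close> abelian and \<open>e\<^sub>3\<close> acting on \<open>V\<close> by a matrix \<open>D\<close>. The kernel of a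
  covector \<open>f\<close> is a subalgebra iff the restriction of \<open>f\<close> to \<open>V\<close> is zero or a left eigenvector of
  \<open>D\<close>; so \<open>V\<close> itself contributes 1, and each left eigenline of \<open>D\<close> contributes \<open>q\<close>.
\<close>

declare card_cart_basis [simp]

section \<open>Hyperplanes as kernels of covectors\<close>

definition hyperplane :: "'k::field ^ 'n::finite \<Rightarrow> ('k ^ 'n) set" where
  "hyperplane f = {x. (\<Sum>i\<in>UNIV. f $ i * x $ i) = 0}"

lemma vec_subspace_hyperplane: "vec.subspace (hyperplane f)"
proof -
  have "(\<Sum>i\<in>UNIV. f $ i * (c * x $ i)) = c * (\<Sum>i\<in>UNIV. f $ i * x $ i)" for c x
    by (simp add: sum_distrib_left mult.left_commute)
  then show ?thesis
    by (simp add: vec.subspace_def hyperplane_def distrib_left sum.distrib)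
qed

lemma sum_axis: "(\<Sum>i\<in>UNIV. f $ i * axis j c $ i) = f $ j * (c :: 'k::field)"
proof -
  have "(\<Sum>i\<in>UNIV. f $ i * axis j c $ i) = (\<Sum>i\<in>UNIV. if i = j then f $ i * c else 0)"
    by (intro sum.cong refl) (simp add: axis_def)
  then show ?thesis by simp
qed

text \<open>A standard basis vector on which \<open>f\<close> does not vanish spans a complement of
  the kernel: subtracting a suitable multiple of it moves any vector into the kernel.\<close>

lemma dim_hyperplane:
  fixes f :: "'k::field ^ 'n::finite"
  assumes "f \<noteq> 0"
  shows "vec.dim (hyperplane f) + 1 = CARD('n)"
proof -
  obtain i where i: "f $ i \<noteq> 0"
    using assms by (auto simp: vec_eq_iff)
  let ?v = "axis i 1 :: 'k ^ 'n"
  have fv: "(\<Sum>j\<in>UNIV. f $ j * ?v $ j) = f $ i"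
    by (simp add: sum_axis)
  have span_hyp: "vec.span (hyperplane f) = hyperplane f"
    using vec_subspace_hyperplane by (simp add: vec.span_eq_iff)
  have "x \<in> vec.span (insert ?v (hyperplane f))" for x
  proof -
    let ?c = "(\<Sum>j\<in>UNIV. f $ j * x $ j) / f $ i"
    have "(\<Sum>j\<in>UNIV. f $ j * (x - ?c *s ?v) $ j)
        = (\<Sum>j\<in>UNIV. f $ j * x $ j) - ?c * (\<Sum>j\<in>UNIV. f $ j * ?v $ j)"
      by (simp add: right_diff_distrib sum_subtractf sum_distrib_left mult.left_commute)
    then have "x - ?c *s ?v \<in> hyperplane f"
      using i fv by (simp add: hyperplane_def)
    then show ?thesis
      unfolding vec.span_breakdown_eq span_hyp by blast
  qed
  then have "vec.span (insert ?v (hyperplane f)) = UNIV"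
    by blast
  then have "vec.dim (insert ?v (hyperplane f)) = CARD('n)"
    by (simp add: vec_dim_card flip: vec.dim_span[of "insert _ _"])
  moreover have "?v \<notin> hyperplane f"
    using i fv by (simp add: hyperplane_def)
  ultimately show ?thesis
    by (simp add: vec.dim_insert span_hyp)
qed

text \<open>The kernel of \<open>f\<close> contains \<open>axis j 1 - axis i (f $ j)\<close> for
  every \<open>j\<close>; that \<open>g\<close> vanishes there too determines \<open>g $ j\<close>
  from \<open>g $ i\<close>.\<close>

lemma hyperplane_subset_imp_proportional:
  fixes f g :: "'k::field ^ 'n::finite"
  assumes "hyperplane f \<subseteq> hyperplane g" and "f $ i = 1"
  shows "g = g $ i *s f"
proof -
  have "g $ j = g $ i * f $ j" for j
  proof -
    have dot: "(\<Sum>l\<in>UNIV. h $ l * (axis j 1 - axis i (f $ j)) $ l) = h $ j - h $ i * f $ j"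
      for h :: "'k ^ 'n"
      by (simp add: right_diff_distrib sum_subtractf sum_axis)
    have "axis j 1 - axis i (f $ j) \<in> hyperplane f"
      unfolding hyperplane_def mem_Collect_eq dot using assms(2) by simp
    then have "axis j 1 - axis i (f $ j) \<in> hyperplane g"
      using assms(1) by blast
    then show ?thesis
      unfolding hyperplane_def mem_Collect_eq dot by (simp add: mult.commute)
  qed
  then show ?thesis unfolding vec_eq_iff vector_smult_component by blast
qed

lemma hyperplane_scale: "c \<noteq> 0 \<Longrightarrow> hyperplane (c *s f) = hyperplane f"
proof -
  assume "c \<noteq> 0"
  moreover have "(\<Sum>i\<in>UNIV. (c *s f) $ i * x $ i) = c * (\<Sum>i\<in>UNIV. f $ i * x $ i)" for x
    by (simp add: sum_distrib_left mult.assoc)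
  ultimately show ?thesis by (simp add: hyperplane_def)
qed

text \<open>A linear map that kills a basis of \<open>S\<close> and fixes some \<open>b\<close>
  outside \<open>S\<close> has a coordinate that is nonzero at \<open>b\<close>. This coordinate is
  a nonzero covector vanishing on \<open>S\<close>, and comparing dimensions turns inclusion into
  equality.\<close>

lemma codim_1_imp_hyperplane:
  fixes S :: "('k::field ^ 'n::finite) set"
  assumes S: "vec.subspace S" and dim: "vec.dim S + 1 = CARD('n)"
  obtains f where "f \<noteq> 0" and "S = hyperplane f"
proof -
  obtain B where B: "B \<subseteq> S" "vec.independent B" "S \<subseteq> vec.span B"
    using vec.basis_exists by metis
  have "S \<noteq> UNIV" using dim vec_dim_card by auto
  moreover have "vec.span B \<subseteq> S" using B(1) S by (simp add: vec.span_minimal)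
  ultimately obtain b where b: "b \<notin> vec.span B" by blast
  then have bB: "vec.independent (insert b B)" "b \<notin> B"
    using B(2) vec.span_base by (auto simp: vec.independent_insert)
  obtain L where L: "Vector_Spaces.linear (*s) (*s) L"
    "\<forall>x\<in>insert b B. L x = (if x = b then b else 0)"
    using vec.linear_independent_extend[OF bB(1), of "\<lambda>x. if x = b then b else 0"] by blast
  have "b \<noteq> 0" using b vec.span_zero by blast
  then obtain i where i: "b $ i \<noteq> 0" by (auto simp: vec_eq_iff)
  define f where "f = matrix L $ i"
  have f: "(\<Sum>j\<in>UNIV. f $ j * x $ j) = L x $ i" for x
    using matrix_works[OF L(1), of x] by (simp add: f_def matrix_vector_mult_def vec_eq_iff)
  have "L x = 0" if "x \<in> B" for x
    using L(2) bB(2) that by auto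
  then have "L x = 0" if "x \<in> vec.span B" for x
    using vec.linear_eq_0_on_span[OF L(1) _ that] by blast
  then have sub: "S \<subseteq> hyperplane f"
    using B(3) by (auto simp: hyperplane_def f)
  have "f \<noteq> 0" using f[of b] L(2) i by auto
  moreover have "S = hyperplane f"
    using vec.subspace_dim_equal[OF S vec_subspace_hyperplane sub] dim_hyperplane[OF \<open>f \<noteq> 0\<close>] dim
    by simp
  ultimately show thesis by (rule that)
qed

section \<open>Counting lines over a finite field\<close>

text \<open>The lines partition the nonzero vectors into classes of size q - 1. The product form
  avoids division of natural numbers.\<close>

lemma card_lines:
  "card {S :: ('k::{field,finite} ^ 'n::finite) set. vec.subspace S \<and> vec.dim S = 1} * (CARD('k) - 1)
    = CARD('k) ^ CARD('n) - 1"
proof -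
  let ?C = "{S :: ('k ^ 'n) set. vec.subspace S \<and> vec.dim S = 1}"
  have line: "S = vec.span {v}" if "S \<in> ?C" "v \<in> S" "v \<noteq> 0" for S v
    using that vec.subspace_dim_equal[OF vec.subspace_span, of S "{v}"]
    by (auto simp: vec.span_minimal)
  have inj: "inj (\<lambda>c. c *s v)" if "v \<noteq> 0" for v :: "'k ^ 'n"
    using that by (auto simp: inj_on_def)
  have "(CARD('k) - 1) * card ((\<lambda>S. S - {0}) ` ?C) = card (\<Union> ((\<lambda>S. S - {0}) ` ?C))"
  proof (rule card_partition)
    fix T assume "T \<in> (\<lambda>S. S - {0}) ` ?C"
    then obtain S where S: "S \<in> ?C" "T = S - {0}" by blast
    then have "S \<noteq> {0}" by auto
    then obtain v where v: "v \<in> S" "v \<noteq> 0"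
      using S(1) vec.subspace_0 by blast
    have "card S = CARD('k)"
      using line[OF S(1) v] card_image[OF inj[OF v(2)]] by (simp add: vec.span_singleton)
    then show "card T = CARD('k) - 1"
      using S vec.subspace_0[of S] by simp
  next
    fix T T' assume *: "T \<in> (\<lambda>S. S - {0}) ` ?C" "T' \<in> (\<lambda>S. S - {0}) ` ?C" "T \<noteq> T'"
    show "T \<inter> T' = {}"
    proof (rule ccontr)
      assume "T \<inter> T' \<noteq> {}"
      then obtain v where "v \<in> T" "v \<in> T'" by blast
      \<comment> \<open>Both lines are the span of their common nonzero vector.\<close>
      with * line show False by (smt (verit, best) DiffE image_iff singletonI)
    qed
  qed simp_all
  moreover have "\<Union> ((\<lambda>S. S - {0}) ` ?C) = UNIV - {0}"
  proof -
    have "vec.span {v} \<in> ?C" "v \<in> vec.span {v} - {0}" if "v \<noteq> 0" for v :: "'k ^ 'n"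
      using that by (simp_all add: vec.span_base)
    then show ?thesis by blast
  qed
  \<comment> \<open>Removing 0 loses no information, as every subspace contains it.\<close>
  moreover have "card ((\<lambda>S. S - {0}) ` ?C) = card ?C"
    by (rule card_image) (metis (no_types, lifting) inj_onI insert_Diff mem_Collect_eq vec.subspace_0)
  ultimately show ?thesis by (simp add: card_Diff_singleton mult.commute CARD_vec)
qed

lemma card_lines_2_3:
  "card {S :: ('k::{field,finite} ^ 2) set. vec.subspace S \<and> vec.dim S = 1} = 1 + CARD('k)"
  "card {S :: ('k ^ 3) set. vec.subspace S \<and> vec.dim S = 1} = 1 + CARD('k) + CARD('k) ^ 2"
proof -
  have "card {0, 1 :: 'k} \<le> CARD('k)" by (intro card_mono) simp_all
  \<comment> \<open>Writing q as \<open>Suc r\<close> eliminates truncated subtraction;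
    \<open>r\<close> is nonzero because 0 and 1 differ, so it can be cancelled at the end.\<close>
  moreover define r where "r = CARD('k) - 1"
  ultimately have r: "CARD('k) = Suc r" and "r \<noteq> 0" by simp_all
  have "Suc r ^ 2 - 1 = (1 + Suc r) * r" "Suc r ^ 3 - 1 = (1 + Suc r + Suc r ^ 2) * r"
    by (simp_all add: power2_eq_square power3_eq_cube algebra_simps)
  then have "card {S :: ('k ^ 2) set. vec.subspace S \<and> vec.dim S = 1} * r = (1 + Suc r) * r"
    and "card {S :: ('k ^ 3) set. vec.subspace S \<and> vec.dim S = 1} * r = (1 + Suc r + Suc r ^ 2) * r"
    using card_lines[where 'k = 'k and 'n = 2] card_lines[where 'k = 'k and 'n = 3]
    unfolding r by simp_all
  then show "card {S :: ('k ^ 2) set. vec.subspace S \<and> vec.dim S = 1} = 1 + CARD('k)"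
    and "card {S :: ('k ^ 3) set. vec.subspace S \<and> vec.dim S = 1} = 1 + CARD('k) + CARD('k) ^ 2"
    using \<open>r \<noteq> 0\<close> unfolding r mult_cancel2 by simp_all
qed

section \<open>Subalgebra counts that do not depend on the bracket\<close>

context
  fixes br :: "('k::{field,finite}, 'n::finite) bracket"
  assumes la: "lie_algebra (*s) cart_basis br"
begin

interpretation L: lie_algebra "(*s)" cart_basis br by (rule la)

lemma subalgebra_count_0: "L.subalgebra_count 0 = 1"
proof -
  have "S = UNIV" if "vec.subspace S" "vec.dim S = CARD('n)" for S :: "('k ^ 'n) set"
    using vec.subspace_dim_equal[OF that(1) vec.subspace_UNIV] that(2) by simp
  then have "{S. L.subalgebra S \<and> vec.dim S + 0 = vec.dim (UNIV :: ('k ^ 'n) set)} = {UNIV}"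
    by (auto simp: L.subalgebra_def)
  then show ?thesis by (simp add: L.subalgebra_count_def)
qed

lemma subalgebra_count_CARD: "L.subalgebra_count CARD('n) = 1"
proof -
  have "br 0 0 = 0" by (rule L.bracket_self)
  then have "{S. L.subalgebra S \<and> vec.dim S + CARD('n) = vec.dim (UNIV :: ('k ^ 'n) set)} = {{0}}"
    using vec.subspace_0
    by (auto simp: L.subalgebra_def vec_dim_card)
  then show ?thesis by (simp add: L.subalgebra_count_def)
qed

lemma subalgebra_count_lines:
  assumes "Suc i = CARD('n)"
  shows "L.subalgebra_count i = card {S :: ('k ^ 'n) set. vec.subspace S \<and> vec.dim S = 1}"
proof -
  have "br x y \<in> S" if S: "vec.subspace S" "vec.dim S = 1" "x \<in> S" "y \<in> S" for x y S
  proof -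
    obtain v where "S = vec.span {v}"
    proof -
      obtain B where "B \<subseteq> S" "vec.independent B" "S \<subseteq> vec.span B" "card B = vec.dim S"
        using vec.basis_exists by metis
      then show thesis
        using that S(1,2) by (metis card_1_singletonE subset_antisym vec.span_minimal)
    qed
    then obtain c d where "x = c *s v" "y = d *s v"
      using S(3,4) by (auto simp: vec.span_singleton)
    then have "br x y = 0"
      by (simp add: L.bracket_scale_left L.bracket_scale_right L.bracket_self)
    then show ?thesis using S(1) by (simp add: vec.subspace_0)
  qed
  then show ?thesis
    unfolding L.subalgebra_count_def L.subalgebra_def vec_dim_card
    by (intro arg_cong[of _ _ card]) (use assms in auto)
qed

end

section \<open>Zeta functions in dimensions one to three\<close>

lemma zeta_dim_1:
  fixes br :: "('k::{field,finite}, 1) bracket"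
  assumes "lie_algebra (*s) cart_basis br"
  shows "zeta br s = 1 + of_nat CARD('k) powr (- s)"
  using subalgebra_count_0[OF assms] subalgebra_count_CARD[OF assms]
  by (simp add: lie_algebra.subalgebra_zeta_def[OF assms] vec_dim_card)

text \<open>In dimension 2 the subspaces of codimension 1 are the lines, so every bracket gives the
  same polynomial.\<close>

lemma zeta_dim_2:
  fixes br :: "('k::{field,finite}, 2) bracket"
  assumes "lie_algebra (*s) cart_basis br" and "t = of_nat CARD('k) powr (- s)"
  shows "zeta br s = 1 + (1 + of_nat CARD('k)) * t + t ^ 2"
  using subalgebra_count_0[OF assms(1)] subalgebra_count_CARD[OF assms(1)]
    subalgebra_count_lines[OF assms(1), of 1] card_lines_2_3(1)[where 'k = 'k] assms(2)
  unfolding lie_algebra.subalgebra_zeta_def[OF assms(1)] vec_dim_card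
  by (simp add: numeral_2_eq_2 atMost_Suc)

text \<open>Codimension 2 means lines here, so only the coefficient of \<open>t\<close> depends on
  the bracket.\<close>

lemma zeta_dim_3:
  fixes br :: "('k::{field,finite}, 3) bracket"
  assumes "lie_algebra (*s) cart_basis br" and "t = of_nat CARD('k) powr (- s)"
    and "lie_algebra.subalgebra_count (*s) br 1 = N"
  shows "zeta br s =
    1 + of_nat N * t + (1 + of_nat CARD('k) + of_nat CARD('k) ^ 2) * t ^ 2 + t ^ 3"
  using subalgebra_count_0[OF assms(1)] subalgebra_count_CARD[OF assms(1)]
    subalgebra_count_lines[OF assms(1), of 2] card_lines_2_3(2)[where 'k = 'k] assms(2,3)
  unfolding lie_algebra.subalgebra_zeta_def[OF assms(1)] vec_dim_card
  by (simp add: numeral_2_eq_2 numeral_3_eq_3 atMost_Suc)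

section \<open>Normalised covectors in dimension three\<close>

lemma vec_3_cases:
  fixes f :: "'k::zero ^ 3"
  obtains x y z where "f = vector [x, y, z]"
proof -
  have "f = vector [f $ 1, f $ 2, f $ 3]" by (simp add: vec_eq_iff forall_3 vector_3)
  then show thesis by (rule that)
qed

lemma vector_3_eq_iff: "(vector [x, y, z] :: 'k::zero ^ 3) = vector [x', y', z'] \<longleftrightarrow> x = x' \<and> y = y' \<and> z = z'"
  by (auto simp: vec_eq_iff forall_3 vector_3)

text \<open>The first nonzero entry is scaled to 1, which picks one representative of each point of
  the projective plane of covectors.\<close>

definition normal_covectors :: "('k::field ^ 3) set" where
  "normal_covectors = {f. f $ 1 = 1 \<or> f $ 1 = 0 \<and> f $ 2 = 1 \<or> f $ 1 = 0 \<and> f $ 2 = 0 \<and> f $ 3 = 1}"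

lemma hyperplane_normal_covector:
  fixes f :: "'k::field ^ 3"
  assumes "f \<noteq> 0"
  obtains g where "g \<in> normal_covectors" "hyperplane f = hyperplane g"
proof -
  define c where "c = (if f $ 1 \<noteq> 0 then f $ 1 else if f $ 2 \<noteq> 0 then f $ 2 else f $ 3)"
  have "c \<noteq> 0" using assms by (auto simp: c_def vec_eq_iff forall_3)
  then have "inverse c *s f \<in> normal_covectors"
    by (auto simp: normal_covectors_def c_def split: if_splits)
  moreover have "hyperplane f = hyperplane (inverse c *s f)"
    using \<open>c \<noteq> 0\<close> by (simp add: hyperplane_scale)
  ultimately show thesis by (rule that)
qed

lemma normal_covectors_nonzero: "0 \<notin> normal_covectors"
  by (simp add: normal_covectors_def)

text \<open>Covectors with the same kernel are proportional, and the leading entry 1 forces the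
  factor to be 1.\<close>

lemma inj_on_hyperplane: "inj_on hyperplane normal_covectors"
proof (rule inj_onI)
  fix f g :: "'k::field ^ 3"
  assume f: "f \<in> normal_covectors" and g: "g \<in> normal_covectors"
    and eq: "hyperplane f = hyperplane g"
  obtain i where "f $ i = 1" using f unfolding normal_covectors_def by blast
  then obtain c where "g = c *s f"
    using hyperplane_subset_imp_proportional eq by blast
  then show "f = g"
    using f g by (auto simp: normal_covectors_def)
qed

section \<open>Semidirect products and left eigenvectors\<close>

text \<open>Here \<open>e\<^sub>3\<close> acts on \<open>\<langle>e\<^sub>1, e\<^sub>2\<rangle>\<close> by the matrix with rows \<open>(\<alpha>, \<beta>)\<close> and \<open>(\<gamma>, \<delta>)\<close>.\<close>

definition semidirect :: "'k \<Rightarrow> 'k \<Rightarrow> 'k \<Rightarrow> 'k \<Rightarrow> ('k::field, 3) bracket" where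
  "semidirect \<alpha> \<beta> \<gamma> \<delta> x y = vector
    [x $ 3 * (\<alpha> * y $ 1 + \<beta> * y $ 2) - y $ 3 * (\<alpha> * x $ 1 + \<beta> * x $ 2),
     x $ 3 * (\<gamma> * y $ 1 + \<delta> * y $ 2) - y $ 3 * (\<gamma> * x $ 1 + \<delta> * x $ 2), 0]"

lemma hyperplane_3: "x \<in> hyperplane (vector [f1, f2, f3] :: 'k::field ^ 3) \<longleftrightarrow>
    f1 * x $ 1 + f2 * x $ 2 + f3 * x $ 3 = 0"
  by (simp add: hyperplane_def sum_3 vector_3)

text \<open>The equation is the vanishing of the 2 by 2 determinant with rows
  \<open>(f1, f2)\<close> and its product with the matrix of the action: the restriction of the
  covector to V is zero or a left eigenvector.\<close>

lemma hyperplane_closed_semidirect_iff: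
  fixes f1 f2 f3 :: "'k::field"
  defines "H \<equiv> hyperplane (vector [f1, f2, f3])"
  assumes norm: "vector [f1, f2, f3] \<in> normal_covectors"
  shows "(\<forall>x\<in>H. \<forall>y\<in>H. semidirect \<alpha> \<beta> \<gamma> \<delta> x y \<in> H) \<longleftrightarrow>
    f1 * (f1 * \<beta> + f2 * \<delta>) = f2 * (f1 * \<alpha> + f2 * \<gamma>)"
proof -
  have cases: "f1 = 1 \<or> f1 = 0 \<and> f2 = 1 \<or> f1 = 0 \<and> f2 = 0 \<and> f3 = 1"
    using norm by (auto simp: normal_covectors_def vector_3)
  show ?thesis
  proof
    assume closed: "\<forall>x\<in>H. \<forall>y\<in>H. semidirect \<alpha> \<beta> \<gamma> \<delta> x y \<in> H"
    (* x spans the intersection of H with V, and y completes it to a basis of H. *)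
    define x :: "'k ^ 3" where "x = vector [f2, - f1, 0]"
    define y :: "'k ^ 3" where "y = (if f1 = 1 then vector [- f3, 0, 1] else vector [0, - f3, 1])"
    have "x \<in> H" by (simp add: H_def x_def hyperplane_3 vector_3)
    show "f1 * (f1 * \<beta> + f2 * \<delta>) = f2 * (f1 * \<alpha> + f2 * \<gamma>)"
    proof (cases "f1 = 0 \<and> f2 = 0")
      case False
      then have "y \<in> H" using cases by (auto simp: H_def y_def hyperplane_3 vector_3)
      then have "semidirect \<alpha> \<beta> \<gamma> \<delta> x y \<in> H" using closed \<open>x \<in> H\<close> by blast
      then show ?thesis
        by (simp add: H_def hyperplane_3 semidirect_def x_def y_def vector_3 algebra_simps split: if_splits)
    qed simp
  next
    assume eig: "f1 * (f1 * \<beta> + f2 * \<delta>) = f2 * (f1 * \<alpha> + f2 * \<gamma>)"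
    have "semidirect \<alpha> \<beta> \<gamma> \<delta> x y \<in> H" if "x \<in> H" "y \<in> H" for x y
    proof -
      have x: "f1 * x $ 1 + f2 * x $ 2 + f3 * x $ 3 = 0" and y: "f1 * y $ 1 + f2 * y $ 2 + f3 * y $ 3 = 0"
        using that by (simp_all add: H_def hyperplane_3)
      \<comment> \<open>The bracket has third entry 0, so \<open>f3\<close> drops out. A leading
        entry 1 in \<open>f1\<close> or \<open>f2\<close> lets the equation of \<open>H\<close> be
        solved for one coordinate; if both vanish, the claim is trivial.\<close>
      have "f1 * (x $ 3 * (\<alpha> * y $ 1 + \<beta> * y $ 2) - y $ 3 * (\<alpha> * x $ 1 + \<beta> * x $ 2)) +
        f2 * (x $ 3 * (\<gamma> * y $ 1 + \<delta> * y $ 2) - y $ 3 * (\<gamma> * x $ 1 + \<delta> * x $ 2)) = 0"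
        using cases
      proof (elim disjE conjE)
        assume "f1 = 1"
        with eig x y show ?thesis by simp algebra
      next
        assume "f1 = 0" "f2 = 1"
        with eig x y show ?thesis by simp algebra
      next
        assume "f1 = 0" "f2 = 0" "f3 = 1"
        with eig x y show ?thesis by simp
      qed
      then show ?thesis by (simp add: H_def hyperplane_3 semidirect_def vector_3)
    qed
    then show "\<forall>x\<in>H. \<forall>y\<in>H. semidirect \<alpha> \<beta> \<gamma> \<delta> x y \<in> H" by blast
  qed
qed

text \<open>
  \<open>(1, u)\<close> is a left eigenvector of the matrix iff \<open>\<beta> + u \<delta> = u (\<alpha> + u \<gamma>)\<close>, and \<open>(0, 1)\<close> is one iff
  \<open>\<gamma> = 0\<close>.
\<close>

lemma subalgebra_count_semidirect:
  fixes \<alpha> \<beta> \<gamma> \<delta> :: "'k::{field,finite}"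
  assumes "lie_algebra (*s) cart_basis (semidirect \<alpha> \<beta> \<gamma> \<delta>)"
  shows "lie_algebra.subalgebra_count (*s) (semidirect \<alpha> \<beta> \<gamma> \<delta>) 1 =
    1 + (card {u. \<beta> + u * \<delta> = u * (\<alpha> + u * \<gamma>)} + (if \<gamma> = 0 then 1 else 0)) * CARD('k)"
proof -
  interpret L: lie_algebra "(*s)" cart_basis "semidirect \<alpha> \<beta> \<gamma> \<delta>" by (rule assms)
  let ?E = "{u. \<beta> + u * \<delta> = u * (\<alpha> + u * \<gamma>)}"
  let ?F = "{f \<in> normal_covectors. L.subalgebra (hyperplane f)}"
  \<comment> \<open>The three families are sorted by leading entry. The free third entry
    \<open>w\<close> gives the factor q, the index set \<open>{w. \<gamma> = 0}\<close> is
    everything or empty and so encodes the conditional, and \<open>?F3\<close> is the covector with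
    kernel V.\<close>
  let ?F1 = "(\<lambda>(u, w). vector [1, u, w]) ` (?E \<times> UNIV) :: ('k ^ 3) set"
  let ?F2 = "(\<lambda>w. vector [0, 1, w]) ` {w. \<gamma> = 0} :: ('k ^ 3) set"
  let ?F3 = "{vector [0, 0, 1]} :: ('k ^ 3) set"
  have mem_F: "vector [f1, f2, f3] \<in> normal_covectors \<and>
      L.subalgebra (hyperplane (vector [f1, f2, f3])) \<longleftrightarrow>
      vector [f1, f2, f3] \<in> normal_covectors \<and>
      f1 * (f1 * \<beta> + f2 * \<delta>) = f2 * (f1 * \<alpha> + f2 * \<gamma>)" for f1 f2 f3
    unfolding L.subalgebra_def
    using hyperplane_closed_semidirect_iff[of f1 f2 f3 \<alpha> \<beta> \<gamma> \<delta>]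
      vec_subspace_hyperplane[of "vector [f1, f2, f3]"] by blast
  have disj: "?F1 \<inter> (?F2 \<union> ?F3) = {}" "?F2 \<inter> ?F3 = {}"
    by (auto simp: vector_3_eq_iff)
  have "{S. L.subalgebra S \<and> vec.dim S + 1 = vec.dim (UNIV :: ('k ^ 3) set)} = hyperplane ` ?F"
    (is "?P = _")
  proof
    show "?P \<subseteq> hyperplane ` ?F"
    proof
      fix S assume S: "S \<in> ?P"
      then have "vec.subspace S" "vec.dim S + 1 = CARD(3)"
        unfolding mem_Collect_eq L.subalgebra_def vec_dim_card by simp_all
      then obtain f where f: "f \<noteq> 0" "S = hyperplane f"
        by (rule codim_1_imp_hyperplane)
      then obtain g where "g \<in> normal_covectors" "S = hyperplane g"
        using hyperplane_normal_covector by metis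
      then show "S \<in> hyperplane ` ?F" using S by blast
    qed
    show "hyperplane ` ?F \<subseteq> ?P"
    proof safe
      fix f assume "f \<in> normal_covectors"
      then have "f \<noteq> 0" using normal_covectors_nonzero by metis
      then show "vec.dim (hyperplane f) + 1 = vec.dim (UNIV :: ('k ^ 3) set)"
        unfolding vec_dim_card by (rule dim_hyperplane)
    qed
  qed
  then have "L.subalgebra_count 1 = card (hyperplane ` ?F)"
    by (simp add: L.subalgebra_count_def)
  also have "\<dots> = card ?F"
    by (intro card_image inj_on_subset[OF inj_on_hyperplane]) auto
  also have "?F = {vector [f1, f2, f3] |f1 f2 f3. vector [f1, f2, f3] \<in> normal_covectors \<and>
      f1 * (f1 * \<beta> + f2 * \<delta>) = f2 * (f1 * \<alpha> + f2 * \<gamma>)}" (is "_ = ?G")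
  proof (rule set_eqI)
    fix f :: "'k ^ 3"
    obtain x y z where "f = vector [x, y, z]" by (rule vec_3_cases)
    then show "f \<in> ?F \<longleftrightarrow> f \<in> ?G"
      using mem_F[of x y z] by (auto simp: vector_3_eq_iff)
  qed
  also have "\<dots> = ?F1 \<union> (?F2 \<union> ?F3)"
    by (auto simp: normal_covectors_def vector_3 vector_3_eq_iff image_iff)
  also have "card \<dots> = card ?F1 + (card ?F2 + card ?F3)"
    by (simp only: card_Un_disjoint[OF finite finite disj(1)] card_Un_disjoint[OF finite finite disj(2)])
  also have "card ?F1 = card ?E * CARD('k)"
    by (subst card_image) (auto simp: inj_on_def vector_3_eq_iff card_cartesian_product)
  also have "card ?F2 = (if \<gamma> = 0 then 1 else 0) * CARD('k)"
    by (subst card_image) (auto simp: inj_on_def vector_3_eq_iff)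
  finally show ?thesis by (simp add: algebra_simps)
qed

section \<open>The algebras of the classification\<close>

lemma brackets_semidirect:
  "L1 = semidirect 0 0 0 (0 :: 'k::field)"
  "L2 = semidirect 1 0 0 (1 :: 'k)"
  "L3 a = semidirect 0 a 1 (1 :: 'k)"
  "L4 a = semidirect 0 a 1 (0 :: 'k)"
  by (simp_all add: fun_eq_iff L1_def L2_def L3_def L4_def bracket_of_def semidirect_def
      vec_eq_iff sum_3 forall_3 vector_3 axis_def algebra_simps)

text \<open>The substitution u = a x, invertible for nonzero \<open>a\<close>, turns each
  eigenvector equation into \<open>a\<close> times the equation defining \<open>V3 a\<close> or
  \<open>V4 a\<close>.\<close>

lemma card_eigenvalues:
  fixes a :: "'k::{field,finite}"
  assumes "a \<noteq> 0"
  shows "card {u. a + u = u * u} = card (V3 a)" and "card {u. a = u * u} = card (V4 a)"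
proof -
  have "bij_betw (\<lambda>x. a * x) (V3 a) {u. a + u = u * u}"
    using assms
    by (intro bij_betwI[where g = "\<lambda>u. u / a"])
       (auto simp: V3_def field_simps power2_eq_square, algebra)
  then show "card {u. a + u = u * u} = card (V3 a)" by (simp add: bij_betw_same_card)
  have "bij_betw (\<lambda>x. a * x) (V4 a) {u. a = u * u}"
    using assms
    by (intro bij_betwI[where g = "\<lambda>u. u / a"])
       (auto simp: V4_def field_simps power2_eq_square)
  then show "card {u. a = u * u} = card (V4 a)" by (simp add: bij_betw_same_card)
qed

theorem theorem1p7:
  fixes a :: "'k::{field,finite}" and s q t :: complex
  assumes "a \<noteq> 0"
    and "q = of_nat CARD('k)"
    and "t = q powr (- s)"
  shows "zeta (L_1_1 :: ('k, 1) bracket) s = 1 + t \<and>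
    zeta (L_2_1 :: ('k, 2) bracket) s = 1 + (1 + q) * t + t ^ 2 \<and>
    zeta (L_2_2 :: ('k, 2) bracket) s = 1 + (1 + q) * t + t ^ 2 \<and>
    zeta (L1 :: ('k, 3) bracket) s = 1 + (1 + q + q ^ 2) * t + (1 + q + q ^ 2) * t ^ 2 + t ^ 3 \<and>
    zeta (L2 :: ('k, 3) bracket) s = 1 + (1 + q + q ^ 2) * t + (1 + q + q ^ 2) * t ^ 2 + t ^ 3 \<and>
    zeta (L3 a) s = 1 + (1 + of_nat (card (V3 a)) * q) * t + (1 + q + q ^ 2) * t ^ 2 + t ^ 3 \<and>
    zeta (L3 (0 :: 'k)) s = 1 + (1 + 2 * q) * t + (1 + q + q ^ 2) * t ^ 2 + t ^ 3 \<and>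
    zeta (L4 a) s = 1 + (1 + of_nat (card (V4 a)) * q) * t + (1 + q + q ^ 2) * t ^ 2 + t ^ 3 \<and>
    zeta (L4 (0 :: 'k)) s = 1 + (1 + q) * t + (1 + q + q ^ 2) * t ^ 2 + t ^ 3"
proof -
  note la = lie_algebras[where 'k = 'k]
  have t: "t = of_nat CARD('k) powr (- s)" using assms by simp
  have zeta3: "zeta (semidirect \<alpha> \<beta> \<gamma> \<delta>) s =
      1 + (1 + of_nat N * q) * t + (1 + q + q ^ 2) * t ^ 2 + t ^ 3"
    if "lie_algebra (*s) cart_basis (semidirect \<alpha> \<beta> \<gamma> \<delta>)"
      and "card {u. \<beta> + u * \<delta> = u * (\<alpha> + u * \<gamma>)} + (if \<gamma> = 0 then 1 else 0) = N"
    for \<alpha> \<beta> \<gamma> \<delta> :: 'k and N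
    using zeta_dim_3[OF that(1) t subalgebra_count_semidirect[OF that(1), unfolded that(2)]] assms(2)
    by simp
  note la3 = la(4-7)[unfolded brackets_semidirect]
  \<comment> \<open>These are the roots of u = u * u, the eigenvector equation of
    \<open>L3 0\<close>.\<close>
  have "{u :: 'k. u = 0 \<or> u = 1} = {0, 1}" by auto
  then have card_idem: "card {u :: 'k. u = 0 \<or> u = 1} = 2" by simp
  \<comment> \<open>Each count of left eigenlines is put in the form N of \<open>zeta3\<close>. For
    \<open>L1\<close> and \<open>L2\<close> the matrix is scalar, so all q + 1 lines of covectors on
    V are eigenlines.\<close>
  have "zeta (L1 :: ('k, 3) bracket) s = 1 + (1 + of_nat (CARD('k) + 1) * q) * t + (1 + q + q ^ 2) * t ^ 2 + t ^ 3"
    "zeta (L2 :: ('k, 3) bracket) s = 1 + (1 + of_nat (CARD('k) + 1) * q) * t + (1 + q + q ^ 2) * t ^ 2 + t ^ 3"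
    "zeta (L3 a) s = 1 + (1 + of_nat (card (V3 a)) * q) * t + (1 + q + q ^ 2) * t ^ 2 + t ^ 3"
    "zeta (L3 (0 :: 'k)) s = 1 + (1 + of_nat 2 * q) * t + (1 + q + q ^ 2) * t ^ 2 + t ^ 3"
    "zeta (L4 a) s = 1 + (1 + of_nat (card (V4 a)) * q) * t + (1 + q + q ^ 2) * t ^ 2 + t ^ 3"
    "zeta (L4 (0 :: 'k)) s = 1 + (1 + of_nat 1 * q) * t + (1 + q + q ^ 2) * t ^ 2 + t ^ 3"
    unfolding brackets_semidirect
    by (rule zeta3, rule la3, simp add: card_eigenvalues[OF assms(1)] card_idem)+
  moreover have "q + q ^ 2 = of_nat (CARD('k) + 1) * q"
    by (simp add: assms(2) power2_eq_square algebra_simps)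
  ultimately show ?thesis
    using zeta_dim_1[OF la(1)] zeta_dim_2[OF la(2) t] zeta_dim_2[OF la(3) t] t assms(2)
    by (simp add: add.assoc)
qed

end
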